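(* Let $n\ge 2$, let $F=q\circ A\circ\ell$ where $A\in\mathbb{R}^{(n+1)\times(n+1)}$ with $\det(A)=\pm 1$, and let $M\in\mathbb{R}^{(n+1)\times(n+1)}$ be an invertible indefinite symmetric matrix. The quadric $\mathcal{Q}(M)$ is $F$-invariant if and only if $A^TMA=\varepsilon M$ for some $\varepsilon\in\{1,-1\}$. As a consequence, in that case (with this $\varepsilon$) the matrix $A$ must be similar to $\varepsilon A^{-1}$.
   Context: Define $q(a_1,\dots,a_{n+1})=(a_1/a_{n+1},\dots,a_n/a_{n+1})$ for $(a_1,\dots,a_{n+1})\in\mathbb{R}^{n+1}$ with $a_{n+1}\neq 0$, and $\ell:\mathbb{R}^n\to\mathbb{R}^{n+1}$, $\ell(a_1,\dots,a_n)=(a_1,\dots,a_n,1)^T$. Let $\mathrm{pr}:\mathbb{R}^{n+1}\to\mathbb{R}$ be the projection on the last, $(n+1)$-th, component. The map $F=q\circ A\circ\ell$, $F(X)=q(A\ell(X))$, is defined on $\mathbb{R}^n\setminus\mathcal{PF}$, where $\mathcal{PF}=\{X\in\mathbb{R}^n : \mathrm{pr}(A\ell(X))=0\}$. A subset $\mathcal{S}\subset\mathbb{R}^n$ is $F$-invariant if $F(\mathcal{S}\setminus\mathcal{PF})\subset\mathcal{S}$. For a symmetric matrix $M\in\mathbb{R}^{(n+1)\times(n+1)}$, $\mathcal{Q}(M)=\{X\in\mathbb{R}^n : \ell(X)^TM\ell(X)=0\}$. *)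

theory Defs
  imports Complex_Main
    "Jordan_Normal_Form.Determinant"
    "Jordan_Normal_Form.Gauss_Jordan_Elimination"
begin

text \<open>
  The space \<open>\<real>\<^sup>n\<close> is \<^term>\<open>carrier_vec n :: real vec set\<close>. Indices start at \<open>0\<close>, so the last
  coordinate of a vector of dimension \<open>n + 1\<close> has index \<open>n\<close>.
\<close>

definition dehom :: "nat \<Rightarrow> real vec \<Rightarrow> real vec" where
  "dehom n a = vec n (\<lambda>i. a $ i / a $ n)"

definition lift :: "nat \<Rightarrow> real vec \<Rightarrow> real vec" where
  "lift n x = vec (n + 1) (\<lambda>i. if i < n then x $ i else 1)"

definition last_proj :: "nat \<Rightarrow> real vec \<Rightarrow> real" where
  "last_proj n a = a $ n"

text \<open>
  On \<open>polar_set n A\<close>, where the map is undefined, the total function below has a junk value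
  (division by zero); it is only applied off that set.
\<close>

definition proj_map :: "nat \<Rightarrow> real mat \<Rightarrow> real vec \<Rightarrow> real vec" where
  "proj_map n A = dehom n \<circ> (*\<^sub>v) A \<circ> lift n"

definition polar_set :: "nat \<Rightarrow> real mat \<Rightarrow> real vec set" where
  "polar_set n A = {X \<in> carrier_vec n. last_proj n (A *\<^sub>v lift n X) = 0}"

definition proj_invariant :: "nat \<Rightarrow> real mat \<Rightarrow> real vec set \<Rightarrow> bool" where
  "proj_invariant n A S \<longleftrightarrow> proj_map n A ` (S - polar_set n A) \<subseteq> S"

definition quadric :: "nat \<Rightarrow> real mat \<Rightarrow> real vec set" where
  "quadric n M = {X \<in> carrier_vec n. lift n X \<bullet> (M *\<^sub>v lift n X) = 0}"

definition symmetric_matrix :: "real mat \<Rightarrow> bool" where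
  "symmetric_matrix M \<longleftrightarrow> transpose_mat M = M"

definition indefinite_matrix :: "real mat \<Rightarrow> bool" where
  "indefinite_matrix M \<longleftrightarrow>
     (\<exists>x \<in> carrier_vec (dim_row M). x \<bullet> (M *\<^sub>v x) > 0) \<and>
     (\<exists>x \<in> carrier_vec (dim_row M). x \<bullet> (M *\<^sub>v x) < 0)"

text \<open>
  The library function \<^const>\<open>mat_inverse\<close> is option-valued; on matrices of nonzero determinant
  the value below is the two-sided inverse.
\<close>

definition inv_mat :: "real mat \<Rightarrow> real mat" where
  "inv_mat A = the (mat_inverse A)"

lemma inv_mat:
  assumes A: "A \<in> carrier_mat n n" and d: "det A \<noteq> 0"
  shows "inv_mat A \<in> carrier_mat n n" "A * inv_mat A = 1\<^sub>m n" "inv_mat A * A = 1\<^sub>m n"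
proof -
  have "mat_inverse A \<noteq> None"
    using mat_inverse(1)[OF A] det_non_zero_imp_unit[OF A d] by metis
  then obtain B where "mat_inverse A = Some B"
    by auto
  then show "inv_mat A \<in> carrier_mat n n" "A * inv_mat A = 1\<^sub>m n" "inv_mat A * A = 1\<^sub>m n"
    using mat_inverse(2)[OF A] by (auto simp: inv_mat_def)
qed

end

theory Submission
  imports Defs "Jordan_Normal_Form.Jordan_Normal_Form_Existence"
begin

text \<open>
  Suppose the quadric is invariant and let \<open>Q\<close>, \<open>Q'\<close> be the quadratic forms of \<open>M\<close> and \<open>A\<^sup>T M A\<close>.
  In homogeneous coordinates invariance says that \<open>Q'\<close> vanishes on the cone \<open>Q = 0\<close> outside two
  hyperplanes. Sweeping out the cone from one of its points \<open>p\<close> by \<open>x \<mapsto> Q(x) p - 2 b(p, x) x\<close>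
  turns this into polynomial identities on the whole space, from which \<open>Q' = k Q\<close>; determinants
  then force \<open>\<bar>k\<bar> = 1\<close>. Given \<open>A\<^sup>T M A = \<epsilon> M\<close>, the matrix \<open>M\<close> conjugates \<open>\<epsilon> A\<^sup>-\<^sup>1\<close> to \<open>A\<^sup>T\<close>, which is
  similar to \<open>A\<close>.
\<close>

subsection \<open>A real matrix is similar to its transpose\<close>

text \<open>Conjugation by the exchange matrix \<open>R\<close>, which is its own inverse, reverses
  both rows and columns. It sends the superdiagonal to the subdiagonal and keeps the
  diagonal.\<close>

lemma similar_jordan_block_transpose:
  "similar_mat (jordan_block n (a :: 'a :: comm_ring_1)) (transpose_mat (jordan_block n a))"
proof -
  define R :: "'a mat" where "R = mat n n (\<lambda>(i, j). if i + j + 1 = n then 1 else 0)"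
  have R: "R \<in> carrier_mat n n" by (simp add: R_def)
  have left: "R * X = mat n n (\<lambda>(i, j). X $$ (n - 1 - i, j))"
    if X: "X \<in> carrier_mat n n" for X
  proof (rule eq_matI)
    fix i j assume "i < dim_row (mat n n (\<lambda>(i, j). X $$ (n - 1 - i, j)))"
      "j < dim_col (mat n n (\<lambda>(i, j). X $$ (n - 1 - i, j)))"
    then have ij: "i < n" "j < n" by auto
    have "(R * X) $$ (i, j) = (\<Sum>k = 0..<n. (if i + k + 1 = n then 1 else 0) * X $$ (k, j))"
      using X ij by (simp add: R_def scalar_prod_def)
    also have "\<dots> = (\<Sum>k = 0..<n. if k = n - 1 - i then X $$ (k, j) else 0)"
      by (rule sum.cong) (use ij in auto)
    also have "\<dots> = X $$ (n - 1 - i, j)" using ij by simp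
    finally show "(R * X) $$ (i, j) = mat n n (\<lambda>(i, j). X $$ (n - 1 - i, j)) $$ (i, j)"
      using ij by simp
  qed (use X R in auto)
  have RT: "transpose_mat R = R" by (rule eq_matI) (auto simp: R_def add.commute)
  \<comment> \<open>\<open>R\<close> is symmetric, so the rule for columns is the transpose of the
    rule for rows.\<close>
  have right: "X * R = mat n n (\<lambda>(i, j). X $$ (i, n - 1 - j))"
    if X: "X \<in> carrier_mat n n" for X
  proof -
    have "transpose_mat (X * R) = R * transpose_mat X"
      using transpose_mult[OF X R] RT by simp
    also have "\<dots> = transpose_mat (mat n n (\<lambda>(i, j). X $$ (i, n - 1 - j)))"
      using X by (subst left) auto
    finally show ?thesis by (simp only: transpose_mat_eq)
  qed
  have RR: "R * R = 1\<^sub>m n"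
    unfolding left[OF R] by (rule eq_matI) (auto simp: R_def)
  have "jordan_block n a = R * transpose_mat (jordan_block n a) * R"
    using R by (subst left) (auto simp: right intro!: eq_matI)
  then show ?thesis
    using R RR by (intro similar_matI[of _ _ R R n]) auto
qed

lemma transpose_diag_block_mat:
  "transpose_mat (diag_block_mat As) = diag_block_mat (map transpose_mat As)"
proof (induction As)
  case (Cons A As)
  show ?case
    by (simp add: Let_def transpose_four_block_mat[OF carrier_matI[OF refl refl]
          zero_carrier_mat zero_carrier_mat carrier_matI[OF refl refl]] flip: Cons)
qed (auto intro!: eq_matI)

lemma similar_mat_transposeI:
  fixes A B :: "'a :: comm_ring_1 mat"
  assumes "similar_mat A B"
  shows "similar_mat (transpose_mat A) (transpose_mat B)"
proof -
  from similar_matD[OF assms] obtain n P Q where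
    c: "{A, B, P, Q} \<subseteq> carrier_mat n n" and i: "P * Q = 1\<^sub>m n" "Q * P = 1\<^sub>m n"
    and e: "A = P * B * Q" by blast
  have c: "A \<in> carrier_mat n n" "B \<in> carrier_mat n n" "P \<in> carrier_mat n n" "Q \<in> carrier_mat n n"
    using c by auto
  have "transpose_mat Q * transpose_mat P = 1\<^sub>m n" "transpose_mat P * transpose_mat Q = 1\<^sub>m n"
    using transpose_mult[OF c(3,4)] transpose_mult[OF c(4,3)] by (metis i transpose_one)+
  moreover have "transpose_mat A = transpose_mat Q * transpose_mat B * transpose_mat P"
    unfolding e using c by (simp add: transpose_mult[of _ n n _ n] assoc_mult_mat[of _ n n _ n _ n])
  ultimately show ?thesis
    using c by (intro similar_matI[of _ _ "transpose_mat Q" "transpose_mat P" n]) auto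
qed

text \<open>Over the complex numbers a Jordan form \<open>J\<close> exists, and reversing each block
  gives the chain A ~ J ~ J^T ~ A^T.\<close>

lemma similar_transpose_complex:
  fixes A :: "complex mat"
  assumes A: "A \<in> carrier_mat n n"
  shows "similar_mat A (transpose_mat A)"
proof -
  obtain as where "char_poly A = (\<Prod>a\<leftarrow>as. [:- a, 1:])"
    using char_poly_factorized[OF A] by blast
  from jordan_nf_exists[OF A this] obtain jb where AJ: "similar_mat A (jordan_matrix jb)"
    by (auto simp: jordan_nf_def)
  let ?Ms = "map (\<lambda>(k, a). (jordan_block k a, transpose_mat (jordan_block k a))) jb"
  have "similar_mat (diag_block_mat (map fst ?Ms)) (diag_block_mat (map snd ?Ms))"
    by (rule similar_diag_mat_block_mat) (auto intro: similar_jordan_block_transpose)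
  moreover have "diag_block_mat (map fst ?Ms) = jordan_matrix jb"
    unfolding jordan_matrix_def by (rule arg_cong[of _ _ diag_block_mat]) auto
  moreover have "diag_block_mat (map snd ?Ms) = transpose_mat (jordan_matrix jb)"
    unfolding jordan_matrix_def transpose_diag_block_mat
    by (rule arg_cong[of _ _ diag_block_mat]) auto
  ultimately have "similar_mat (jordan_matrix jb) (transpose_mat (jordan_matrix jb))" by simp
  with AJ show ?thesis
    by (meson similar_mat_transposeI similar_mat_trans similar_mat_sym)
qed

text \<open>
  If \<open>P\<close> intertwines over \<open>\<complex>\<close>, so does \<open>Re P + t Im P\<close> for every real \<open>t\<close>; its determinant is
  a polynomial in \<open>t\<close> whose value at \<open>\<i>\<close> is \<open>det P\<close>, so it is nonzero for some real \<open>t\<close>.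
\<close>
lemma similar_of_real_mat:
  fixes A B :: "real mat"
  assumes A: "A \<in> carrier_mat n n" and B: "B \<in> carrier_mat n n"
    and sim: "similar_mat (map_mat complex_of_real A) (map_mat complex_of_real B)"
  shows "similar_mat A B"
proof -
  from similar_matD[OF sim] obtain m P Q where
    c: "{map_mat complex_of_real A, map_mat complex_of_real B, P, Q} \<subseteq> carrier_mat m m"
    and i: "P * Q = 1\<^sub>m m" "Q * P = 1\<^sub>m m"
    and e: "map_mat complex_of_real A = P * map_mat complex_of_real B * Q" by blast
  have "m = n" using c A by auto
  then have P: "P \<in> carrier_mat n n" and Q: "Q \<in> carrier_mat n n" using c by auto
  have "map_mat complex_of_real A * P = P * map_mat complex_of_real B * (Q * P)"
    unfolding e using P Q B by (simp add: assoc_mult_mat[of _ n n _ n _ n])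
  then have comm: "map_mat complex_of_real A * P = P * map_mat complex_of_real B"
    using i P B \<open>m = n\<close> by simp
  define N where "N = mat n n (\<lambda>(i, j). [:Re (P $$ (i, j)), Im (P $$ (i, j)):])"
  have N: "N \<in> carrier_mat n n" by (simp add: N_def)
  have "det P * det Q = 1" using det_mult[OF P Q] i \<open>m = n\<close> by simp
  then have dP: "det P \<noteq> 0" by auto
  interpret mp: map_poly_comm_ring_hom complex_of_real ..
  \<comment> \<open>Evaluating a real polynomial at \<i> is a ring homomorphism, so it commutes with
    \<open>det\<close>; it maps \<open>N\<close> to \<open>P\<close>.\<close>
  interpret hc: comm_ring_hom "\<lambda>p. poly (map_poly complex_of_real p) \<i>"
    by unfold_locales (auto simp: mp.hom_add mp.hom_mult)
  have "map_mat (\<lambda>p. poly (map_poly complex_of_real p) \<i>) N = P"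
    using P by (intro eq_matI) (auto simp: N_def of_real_hom.map_poly_pCons_hom complex_eq_iff)
  then have "poly (map_poly complex_of_real (det N)) \<i> = det P"
    by (metis hc.hom_det)
  then have "det N \<noteq> 0" using dP by auto
  then obtain t where t: "poly (det N) t \<noteq> 0"
    using poly_all_0_iff_0 by blast
  define S where "S = map_mat (\<lambda>p. poly p t) N"
  have S: "S \<in> carrier_mat n n" using N by (simp add: S_def)
  have dS: "det S \<noteq> 0"
    using t by (simp add: S_def comm_ring_hom.hom_det[OF poly_hom.comm_ring_hom_axioms])
  have Sij: "S $$ (i, j) = Re (P $$ (i, j)) + t * Im (P $$ (i, j))" if "i < n" "j < n" for i j
    using that by (simp add: S_def N_def)
  have AS: "A * S = S * B"
  proof (rule eq_matI)
    fix i j assume "i < dim_row (S * B)" "j < dim_col (S * B)"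
    then have ij: "i < n" "j < n" using S B by auto
    have "(map_mat complex_of_real A * P) $$ (i, j) = (P * map_mat complex_of_real B) $$ (i, j)"
      by (simp add: comm)
    then have eq: "(\<Sum>k = 0..<n. complex_of_real (A $$ (i, k)) * P $$ (k, j)) =
        (\<Sum>k = 0..<n. P $$ (i, k) * complex_of_real (B $$ (k, j)))"
      using ij A B P by (simp add: scalar_prod_def)
    \<comment> \<open>\<open>A\<close> and \<open>B\<close> have real entries, so the intertwining
      relation splits into real and imaginary parts.\<close>
    have r: "(\<Sum>k = 0..<n. A $$ (i, k) * Re (P $$ (k, j))) =
        (\<Sum>k = 0..<n. Re (P $$ (i, k)) * B $$ (k, j))"
      using arg_cong[OF eq, of Re] by simp
    have m: "(\<Sum>k = 0..<n. A $$ (i, k) * Im (P $$ (k, j))) =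
        (\<Sum>k = 0..<n. Im (P $$ (i, k)) * B $$ (k, j))"
      using arg_cong[OF eq, of Im] by simp
    have "(A * S) $$ (i, j) = (\<Sum>k = 0..<n. A $$ (i, k) * Re (P $$ (k, j))) +
        t * (\<Sum>k = 0..<n. A $$ (i, k) * Im (P $$ (k, j)))"
      using ij A S by (simp add: scalar_prod_def Sij algebra_simps sum.distrib sum_distrib_left)
    also have "\<dots> = (S * B) $$ (i, j)"
      unfolding r m
      using ij B S by (simp add: scalar_prod_def Sij algebra_simps sum.distrib sum_distrib_left)
    finally show "(A * S) $$ (i, j) = (S * B) $$ (i, j)" .
  qed (use A B S in auto)
  note I = inv_mat[OF S dS]
  have "S * B * inv_mat S = A"
    unfolding AS[symmetric] using A S I by (simp add: assoc_mult_mat[of _ n n _ n _ n])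
  then show ?thesis
    using A B S I by (intro similar_matI[of _ _ S "inv_mat S" n]) auto
qed

lemma similar_transpose_real:
  fixes A :: "real mat"
  assumes A: "A \<in> carrier_mat n n"
  shows "similar_mat A (transpose_mat A)"
proof (rule similar_of_real_mat[OF A])
  show "similar_mat (map_mat complex_of_real A) (map_mat complex_of_real (transpose_mat A))"
    using similar_transpose_complex[of "map_mat complex_of_real A" n] A
    by (simp add: map_mat_transpose)
qed (use A in auto)

subsection \<open>Symmetric bilinear forms and functions polynomial along lines\<close>

definition bform :: "real mat \<Rightarrow> real vec \<Rightarrow> real vec \<Rightarrow> real" where
  "bform M x y = x \<bullet> (M *\<^sub>v y)"

locale symmetric_form =
  fixes N :: nat and M :: "real mat"
  assumes carrier: "M \<in> carrier_mat N N" and sym: "transpose_mat M = M"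
begin

lemma commute:
  assumes "x \<in> carrier_vec N" "y \<in> carrier_vec N"
  shows "bform M x y = bform M y x"
proof -
  have "bform M x y = (M *\<^sub>v x) \<bullet> y"
    using transpose_vec_mult_scalar[OF carrier assms(2,1)] by (simp add: bform_def sym)
  then show ?thesis
    using assms carrier by (simp add: bform_def comm_scalar_prod[of _ N])
qed

lemma add_right:
  "\<lbrakk>x \<in> carrier_vec N; y \<in> carrier_vec N; z \<in> carrier_vec N\<rbrakk>
    \<Longrightarrow> bform M x (y + z) = bform M x y + bform M x z"
  using carrier
  by (simp add: bform_def mult_add_distrib_mat_vec[OF carrier] scalar_prod_add_distrib[of _ N])

lemma smult_right:
  "\<lbrakk>x \<in> carrier_vec N; y \<in> carrier_vec N\<rbrakk> \<Longrightarrow> bform M x (c \<cdot>\<^sub>v y) = c * bform M x y"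
  using carrier by (simp add: bform_def mult_mat_vec[OF carrier])

lemma add_left:
  "\<lbrakk>x \<in> carrier_vec N; y \<in> carrier_vec N; z \<in> carrier_vec N\<rbrakk>
    \<Longrightarrow> bform M (x + y) z = bform M x z + bform M y z"
  using carrier by (simp add: bform_def add_scalar_prod_distrib[of _ N])

lemma smult_left:
  "\<lbrakk>x \<in> carrier_vec N; y \<in> carrier_vec N\<rbrakk> \<Longrightarrow> bform M (c \<cdot>\<^sub>v x) y = c * bform M x y"
  using carrier by (simp add: bform_def)

lemma smult_mat:
  "\<lbrakk>x \<in> carrier_vec N; y \<in> carrier_vec N\<rbrakk> \<Longrightarrow> bform (c \<cdot>\<^sub>m M) x y = c * bform M x y"
proof -
  assume "x \<in> carrier_vec N" "y \<in> carrier_vec N"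
  moreover from this have "(c \<cdot>\<^sub>m M) *\<^sub>v y = c \<cdot>\<^sub>v (M *\<^sub>v y)"
    using carrier by (intro eq_vecI) auto
  ultimately show ?thesis
    using carrier by (simp add: bform_def)
qed

lemmas bilinear = add_right smult_right add_left smult_left

lemma unit_vec_entry:
  assumes "i < N" "j < N"
  shows "bform M (unit_vec N i) (unit_vec N j) = M $$ (i, j)"
  using assms carrier by (simp add: bform_def)

end

text \<open>A substitute for multivariate polynomials: only restrictions to affine lines are
  required to be polynomial. This suffices for cancelling factors that are not identically
  zero.\<close>

definition line_poly :: "nat \<Rightarrow> (real vec \<Rightarrow> real) \<Rightarrow> bool" where
  "line_poly N f \<longleftrightarrow>
     (\<forall>x \<in> carrier_vec N. \<forall>y \<in> carrier_vec N. \<exists>q. \<forall>t. f (x + t \<cdot>\<^sub>v y) = poly q t)"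

lemma line_poly_mult [intro]:
  assumes "line_poly N f" "line_poly N g" shows "line_poly N (\<lambda>x. f x * g x)"
  using assms unfolding line_poly_def by (metis poly_mult)

lemma line_poly_diff [intro]:
  assumes "line_poly N f" "line_poly N g" shows "line_poly N (\<lambda>x. f x - g x)"
  using assms unfolding line_poly_def by (metis poly_diff)

lemma line_poly_const [intro]: "line_poly N (\<lambda>x. c)"
  unfolding line_poly_def by (metis poly_pCons poly_0 mult_zero_right add.right_neutral)

lemma line_poly_scalar_prod [intro]:
  assumes "a \<in> carrier_vec N" shows "line_poly N (\<lambda>x. a \<bullet> x)"
  unfolding line_poly_def
proof (intro ballI)
  fix x y :: "real vec" assume "x \<in> carrier_vec N" "y \<in> carrier_vec N"
  with assms have "a \<bullet> (x + t \<cdot>\<^sub>v y) = poly [:a \<bullet> x, a \<bullet> y:] t" for t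
    by (simp add: scalar_prod_add_distrib[of _ N])
  then show "\<exists>q. \<forall>t. a \<bullet> (x + t \<cdot>\<^sub>v y) = poly q t" by blast
qed

lemma (in symmetric_form) line_poly_linear [intro]:
  assumes "p \<in> carrier_vec N" shows "line_poly N (bform M p)"
  unfolding line_poly_def
proof (intro ballI)
  fix x y :: "real vec" assume "x \<in> carrier_vec N" "y \<in> carrier_vec N"
  with assms have "bform M p (x + t \<cdot>\<^sub>v y) = poly [:bform M p x, bform M p y:] t" for t
    by (simp add: bilinear)
  then show "\<exists>q. \<forall>t. bform M p (x + t \<cdot>\<^sub>v y) = poly q t" by blast
qed

lemma (in symmetric_form) line_poly_quadratic [intro]: "line_poly N (\<lambda>x. bform M x x)"
  unfolding line_poly_def
proof (intro ballI)
  fix x y :: "real vec" assume "x \<in> carrier_vec N" "y \<in> carrier_vec N"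
  then have "bform M (x + t \<cdot>\<^sub>v y) (x + t \<cdot>\<^sub>v y) =
      poly [:bform M x x, 2 * bform M x y, bform M y y:] t" for t
    by (simp add: bilinear commute[of y x] algebra_simps)
  then show "\<exists>q. \<forall>t. bform M (x + t \<cdot>\<^sub>v y) (x + t \<cdot>\<^sub>v y) = poly q t" by blast
qed

text \<open>On the line from \<open>x0\<close> (at t = 0) to \<open>x\<close> (at t = 1) the two
  restrictions are univariate polynomials with product zero. The first is nonzero at 0, so the
  second is the zero polynomial.\<close>

lemma line_poly_mult_eq_0D:
  assumes "line_poly N f" "line_poly N g"
    and fg: "\<And>x. x \<in> carrier_vec N \<Longrightarrow> f x * g x = 0"
    and x0: "x0 \<in> carrier_vec N" "f x0 \<noteq> 0"
    and x: "x \<in> carrier_vec N"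
  shows "g x = 0"
proof -
  have d: "x - x0 \<in> carrier_vec N" using x x0 by simp
  obtain r where r: "\<And>t. f (x0 + t \<cdot>\<^sub>v (x - x0)) = poly r t"
    using assms(1) x0(1) d unfolding line_poly_def by blast
  obtain s where s: "\<And>t. g (x0 + t \<cdot>\<^sub>v (x - x0)) = poly s t"
    using assms(2) x0(1) d unfolding line_poly_def by blast
  have "poly (r * s) t = 0" for t
    using fg[of "x0 + t \<cdot>\<^sub>v (x - x0)"] x0(1) d by (simp add: r s)
  then have "r * s = 0" using poly_all_0_iff_0 by blast
  moreover have "x0 + 0 \<cdot>\<^sub>v (x - x0) = x0" "x0 + 1 \<cdot>\<^sub>v (x - x0) = x"
    using x0 x by auto
  ultimately show ?thesis using r[of 0] s[of 1] x0(2) by auto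
qed

subsection \<open>Quadratic forms vanishing on an indefinite cone\<close>

locale nondegenerate_form = symmetric_form +
  assumes nondegenerate: "det M \<noteq> 0"
begin

lemma eq_0_if_orthogonal:
  assumes "x \<in> carrier_vec N" and "\<And>y. y \<in> carrier_vec N \<Longrightarrow> bform M y x = 0"
  shows "x = 0\<^sub>v N"
proof -
  have "M *\<^sub>v x \<in> carrier_vec N" using carrier assms(1) by simp
  \<comment> \<open>The test vector y = M x turns orthogonality into a vanishing Euclidean norm of M
    x.\<close>
  moreover from this have "(M *\<^sub>v x) \<bullet> (M *\<^sub>v x) = 0"
    using assms(2)[of "M *\<^sub>v x"] by (simp add: bform_def)
  ultimately have "M *\<^sub>v x = 0\<^sub>v N"
    using conjugate_square_eq_0_vec[of "M *\<^sub>v x" N] by simp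
  then show ?thesis
    using det_0_iff_vec_prod_zero[OF carrier] nondegenerate assms(1) by blast
qed

text \<open>Such a \<open>z\<close> shows that the linear form \<open>bform M p\<close> is not
  identically zero, so it can be cancelled from identities; it also spans a complement of the
  hyperplane orthogonal to \<open>p\<close>.\<close>

lemma dual_vec:
  assumes p: "p \<in> carrier_vec N" "p \<noteq> 0\<^sub>v N"
  obtains z where "z \<in> carrier_vec N" "bform M p z = 1"
proof -
  obtain y where y: "y \<in> carrier_vec N" "bform M y p \<noteq> 0"
    using eq_0_if_orthogonal[OF p(1)] p(2) by blast
  show thesis
    by (rule that[of "inverse (bform M p y) \<cdot>\<^sub>v y"])
      (use y p in \<open>auto simp: bilinear commute[of y p]\<close>)
qed

text \<open>If the form vanished on the hyperplane orthogonal to \<open>p\<close>, nondegeneracy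
  would force that hyperplane into the line spanned by \<open>p\<close>, although its dimension is N
  - 1 \<ge> 2.\<close>

lemma anisotropic_in_orthogonal:
  assumes p: "p \<in> carrier_vec N" "p \<noteq> 0\<^sub>v N" and N: "N \<ge> 3"
  obtains x where "x \<in> carrier_vec N" "bform M p x = 0" "bform M x x \<noteq> 0"
proof (rule ccontr)
  assume "\<not> thesis"
  then have iso: "bform M x x = 0" if "x \<in> carrier_vec N" "bform M p x = 0" for x
    using that by (auto intro: \<open>\<And>x. \<lbrakk>x \<in> carrier_vec N; bform M p x = 0; bform M x x \<noteq> 0\<rbrakk> \<Longrightarrow> thesis\<close>)
  obtain z where z: "z \<in> carrier_vec N" "bform M p z = 1" using dual_vec[OF p] .
  have orth: "bform M x y = 0"
    if "x \<in> carrier_vec N" "bform M p x = 0" "y \<in> carrier_vec N" "bform M p y = 0" for x y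
    using iso[of "x + y"] iso[of x] iso[of y] that p by (simp add: bilinear commute[of y x])
  have mult: "x = bform M x z \<cdot>\<^sub>v p" if x: "x \<in> carrier_vec N" "bform M p x = 0" for x
  proof -
    have eq: "x + (- bform M x z) \<cdot>\<^sub>v p = 0\<^sub>v N"
    proof (rule eq_0_if_orthogonal)
      fix y :: "real vec" assume y: "y \<in> carrier_vec N"
      \<comment> \<open>Subtracting a multiple of \<open>z\<close> projects \<open>y\<close> into
        the hyperplane orthogonal to \<open>p\<close>, where \<open>orth\<close> applies.\<close>
      have "bform M x (y + (- bform M p y) \<cdot>\<^sub>v z) = 0"
        using x y z p by (subst orth) (simp_all add: bilinear)
      then show "bform M y (x + (- bform M x z) \<cdot>\<^sub>v p) = 0"
        using x y z p by (simp add: bilinear commute[of y x] commute[of y p])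
    qed (use x p in simp)
    have "x $ i + (- bform M x z) * p $ i = 0" if "i < N" for i
      using that p x arg_cong[OF eq, of "\<lambda>v. v $ i"] by simp
    then show ?thesis using x p by (intro eq_vecI) auto
  qed
  define f where "f i = bform M p (unit_vec N i)" for i
  obtain j where j: "j < N" "f j \<noteq> 0"
  proof (rule ccontr)
    assume "\<not> thesis"
    then have f0: "f i = 0" if "i < N" for i using that \<open>\<And>j. \<lbrakk>j < N; f j \<noteq> 0\<rbrakk> \<Longrightarrow> thesis\<close> by blast
    have "M *\<^sub>v p = 0\<^sub>v N"
    proof (rule eq_vecI)
      fix i assume "i < dim_vec (0\<^sub>v N :: real vec)"
      then show "(M *\<^sub>v p) $ i = 0\<^sub>v N $ i"
        using f0[of i] p carrier commute[of p "unit_vec N i"] by (simp add: f_def bform_def)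
    qed (use carrier in simp)
    then show False
      using det_0_iff_vec_prod_zero[OF carrier] nondegenerate p by blast
  qed
  \<comment> \<open>These vectors are orthogonal to \<open>p\<close> by construction, so each is a
    multiple of \<open>p\<close>. Two indices besides \<open>j\<close> exist since N \<ge> 3:
    \<open>v k\<close> has entry \<open>f j\<close> at \<open>k\<close> and 0 at \<open>k'\<close>,
    forcing \<open>p $ k' = 0\<close>, which contradicts the entry \<open>f j\<close> of
    \<open>v k'\<close> at \<open>k'\<close>.\<close>
  define v where "v k = f j \<cdot>\<^sub>v unit_vec N k + (- f k) \<cdot>\<^sub>v unit_vec N j" for k
  have v: "v k = bform M (v k) z \<cdot>\<^sub>v p" for k
    using p by (subst mult[symmetric]) (simp_all add: v_def bilinear f_def)
  have "\<exists>k k'. k < N \<and> k' < N \<and> k \<noteq> k' \<and> k \<noteq> j \<and> k' \<noteq> j"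
  proof -
    have "card ({..<N} - {j}) \<ge> 2" using N j by simp
    then obtain k k' where "k \<in> {..<N} - {j}" "k' \<in> {..<N} - {j}" "k \<noteq> k'"
      by (metis card_le_Suc0_iff_eq finite_Diff finite_lessThan not_less_eq_eq numeral_2_eq_2)
    then show ?thesis by blast
  qed
  then obtain k k' where k: "k < N" "k' < N" "k \<noteq> k'" "k \<noteq> j" "k' \<noteq> j" by blast
  have "f j = bform M (v k) z * p $ k" "0 = bform M (v k) z * p $ k'" "f j = bform M (v k') z * p $ k'"
    using arg_cong[OF v[of k], of "\<lambda>x. x $ k"] arg_cong[OF v[of k], of "\<lambda>x. x $ k'"]
      arg_cong[OF v[of k'], of "\<lambda>x. x $ k'"] k j p(1) by (simp_all add: v_def)
  with j(2) show False by auto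
qed

text \<open>Along the line u + t w the form is the quadratic c + 2 b t + a t^2. Since a < 0 < c, its
  discriminant is positive, and \<open>t\<close> is one of its real roots.\<close>

lemma isotropic_vec:
  assumes u: "u \<in> carrier_vec N" "bform M u u > 0" and w: "w \<in> carrier_vec N" "bform M w w < 0"
  obtains p where "p \<in> carrier_vec N" "p \<noteq> 0\<^sub>v N" "bform M p p = 0"
proof -
  define a b c where "a = bform M w w" and "b = bform M u w" and "c = bform M u u"
  define t where "t = (- b - sqrt (b\<^sup>2 - a * c)) / a"
  have ac: "a < 0" "c > 0" using u w by (auto simp: a_def c_def)
  then have "b\<^sup>2 - a * c \<ge> 0" by (smt (verit) mult_neg_pos zero_le_power2)
  then have "(sqrt (b\<^sup>2 - a * c))\<^sup>2 = b\<^sup>2 - a * c" by simp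
  moreover have "sqrt (b\<^sup>2 - a * c) = - (b + a * t)" using ac by (simp add: t_def)
  ultimately have "(b + a * t)\<^sup>2 = b\<^sup>2 - a * c" by (simp only: power2_minus)
  then have "a * (c + 2 * t * b + t\<^sup>2 * a) = 0" by (simp add: power2_eq_square algebra_simps)
  then have root: "c + 2 * t * b + t\<^sup>2 * a = 0" using ac by simp
  have Q: "bform M (u + s \<cdot>\<^sub>v w) (u + s \<cdot>\<^sub>v w) = c + 2 * s * b + s\<^sup>2 * a" for s
    using u w by (simp add: bilinear commute[of w u] a_def b_def c_def power2_eq_square algebra_simps)
  \<comment> \<open>If u = - t w, then c = t^2 a \<le> 0, contrary to c > 0.\<close>
  have "u + t \<cdot>\<^sub>v w \<noteq> 0\<^sub>v N"
  proof
    assume 0: "u + t \<cdot>\<^sub>v w = 0\<^sub>v N"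
    have "bform M (u + t \<cdot>\<^sub>v w) u = 0" "bform M (u + t \<cdot>\<^sub>v w) w = 0"
      unfolding 0 using carrier u w by (simp_all add: bform_def)
    then have "c + t * b = 0" "b + t * a = 0"
      using u w by (simp_all add: bilinear commute[of w u] a_def b_def c_def)
    then have "b = - (t * a)" "c = - (t * b)" by simp_all
    then have "c = t\<^sup>2 * a" by (simp add: power2_eq_square)
    with ac show False by (smt (verit) mult_nonneg_nonpos zero_le_power2)
  qed
  then show thesis
    using Q[of t] root u w by (intro that[of "u + t \<cdot>\<^sub>v w"]) auto
qed

text \<open>The vectors \<open>a\<close> and \<open>c\<close> describe the two hyperplanes off which
  vanishing is known. Pulling back along the parametrization of the cone makes them polynomial
  factors, which can be cancelled.\<close>

lemma quadratic_form_multiple: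
  assumes B: "symmetric_form N B" and N: "N \<ge> 3"
    and p: "p \<in> carrier_vec N" "p \<noteq> 0\<^sub>v N" "bform M p p = 0"
    and a: "a \<in> carrier_vec N" "a \<noteq> 0\<^sub>v N" and c: "c \<in> carrier_vec N" "c \<noteq> 0\<^sub>v N"
    and vanish: "\<And>x. \<lbrakk>x \<in> carrier_vec N; bform M x x = 0; a \<bullet> x \<noteq> 0; c \<bullet> x \<noteq> 0\<rbrakk>
      \<Longrightarrow> bform B x x = 0"
  shows "\<exists>k. B = k \<cdot>\<^sub>m M"
proof -
  interpret B: symmetric_form N B by (fact B)
  obtain z where z: "z \<in> carrier_vec N" "bform M p z = 1" using dual_vec[OF p(1,2)] .
  obtain e where e: "e \<in> carrier_vec N" "bform M p e = 0" "bform M e e \<noteq> 0"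
    using anisotropic_in_orthogonal[OF p(1,2) N] .
  \<comment> \<open>\<open>y x\<close> is a multiple of the second point where the plane of
    \<open>p\<close> and \<open>x\<close> meets the cone, scaled to avoid dividing by
    \<open>bform M p x\<close>. Below, \<open>l d\<close> and \<open>g\<close> are the pullbacks
    along \<open>y\<close> of the linear form of \<open>d\<close> and of the quadratic form of
    \<open>B\<close>.\<close>
  define y where "y x = bform M x x \<cdot>\<^sub>v p + (- 2 * bform M p x) \<cdot>\<^sub>v x" for x
  define l where "l d x = bform M x x * (d \<bullet> p) - 2 * bform M p x * (d \<bullet> x)" for d x
  define g where "g x = (bform M x x)\<^sup>2 * bform B p p
      - 4 * bform M x x * bform M p x * bform B p x + 4 * (bform M p x)\<^sup>2 * bform B x x" for x
  have yc: "y x \<in> carrier_vec N" if "x \<in> carrier_vec N" for x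
    using that p by (simp add: y_def)
  have yiso: "bform M (y x) (y x) = 0" if "x \<in> carrier_vec N" for x
    using that p by (simp add: y_def bilinear commute[of x p] algebra_simps)
  have yl: "d \<bullet> y x = l d x" if "x \<in> carrier_vec N" "d \<in> carrier_vec N" for d x
    using that p by (simp add: y_def l_def scalar_prod_add_distrib[of _ N])
  have yg: "bform B (y x) (y x) = g x" if "x \<in> carrier_vec N" for x
    using that p
    by (simp add: y_def g_def B.bilinear B.commute[of x p] power2_eq_square algebra_simps)
  have line_l: "line_poly N (l d)" if "d \<in> carrier_vec N" for d
    unfolding l_def using that p by (intro line_poly_diff line_poly_mult line_poly_const
        line_poly_quadratic line_poly_linear line_poly_scalar_prod)
  have "line_poly N (\<lambda>x. (bform M x x * bform M x x) * bform B p p -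
      ((4 * bform M x x) * bform M p x * bform B p x - (4 * (bform M p x * bform M p x)) * bform B x x))"
    using p by (intro line_poly_diff line_poly_mult line_poly_const line_poly_quadratic
        line_poly_linear B.line_poly_quadratic B.line_poly_linear)
  moreover have "(\<lambda>x. (bform M x x * bform M x x) * bform B p p -
      ((4 * bform M x x) * bform M p x * bform B p x - (4 * (bform M p x * bform M p x)) * bform B x x)) = g"
    by (simp add: g_def fun_eq_iff power2_eq_square)
  ultimately have line_g: "line_poly N g" by simp
  \<comment> \<open>If d and p are not Euclidean-orthogonal, the value at \<open>e\<close> is
    nonzero. Otherwise l d = 0 would give b(p, x) (d \<bullet> x) = 0; cancelling b(p, x) and taking
    x = d yields d = 0.\<close>
  have lnz: "\<exists>x \<in> carrier_vec N. l d x \<noteq> 0" if d: "d \<in> carrier_vec N" "d \<noteq> 0\<^sub>v N" for d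
  proof (cases "d \<bullet> p = 0")
    case False
    then show ?thesis using e by (intro bexI[of _ e]) (simp_all add: l_def)
  next
    case True
    show ?thesis
    proof (rule ccontr)
      assume "\<not> ?thesis"
      then have "bform M p x * (d \<bullet> x) = 0" if "x \<in> carrier_vec N" for x
        using that True by (auto simp: l_def)
      then have "d \<bullet> d = 0"
        by (rule line_poly_mult_eq_0D[of N "bform M p" "\<lambda>x. d \<bullet> x" z d, rotated 2])
          (use p z d in auto)
      then show False using d conjugate_square_eq_0_vec[of d N] by simp
    qed
  qed
  obtain xa where xa: "xa \<in> carrier_vec N" "l a xa \<noteq> 0" using lnz[OF a] by blast
  obtain xc where xc: "xc \<in> carrier_vec N" "l c xc \<noteq> 0" using lnz[OF c] by blast
  \<comment> \<open>Either a linear factor vanishes, or \<open>y x\<close> is a cone point off both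
    hyperplanes and \<open>vanish\<close> gives g x = 0.\<close>
  have prod: "l a x * (l c x * g x) = 0" if "x \<in> carrier_vec N" for x
    using vanish[OF yc yiso] yl[of x] yg[of x] that a c by auto
  have "l c x * g x = 0" if "x \<in> carrier_vec N" for x
    using line_poly_mult_eq_0D[OF line_l[OF a(1)] line_poly_mult[OF line_l[OF c(1)] line_g] prod xa that] .
  then have g0: "g x = 0" if "x \<in> carrier_vec N" for x
    using line_poly_mult_eq_0D[OF line_l[OF c(1)] line_g _ xc that] by blast
  \<comment> \<open>At \<open>e\<close> only the first term of \<open>g\<close> survives, because
    b(p, e) = 0.\<close>
  have Bpp: "bform B p p = 0" using g0[OF e(1)] e by (simp add: g_def)
  \<comment> \<open>With \<open>Bpp\<close>, \<open>g\<close> is 4 b(p, x) times this expression;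
    one factor b(p, x) is cancelled.\<close>
  have key: "bform M p x * bform B x x - bform M x x * bform B p x = 0" if x: "x \<in> carrier_vec N" for x
  proof (rule line_poly_mult_eq_0D[of N "bform M p"
        "\<lambda>x. bform M p x * bform B x x - bform M x x * bform B p x" z])
    show "line_poly N (\<lambda>x. bform M p x * bform B x x - bform M x x * bform B p x)"
      using p by (intro line_poly_diff line_poly_mult line_poly_quadratic
        line_poly_linear B.line_poly_quadratic B.line_poly_linear)
    show "bform M p x * (bform M p x * bform B x x - bform M x x * bform B p x) = 0"
      if "x \<in> carrier_vec N" for x
      using g0[OF that] by (simp add: g_def Bpp power2_eq_square algebra_simps)
  qed (use p z x in auto)
  have Be: "bform B p e = 0" using key[OF e(1)] e by simp
  \<comment> \<open>The second difference of s \<mapsto> Q(x + s e) over -1, 0, 1 is 2 Q(e) \<noteq>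
    0, so Q(x + s e) is nonzero for some such \<open>s\<close>, and B(p, x) must vanish.\<close>
  have ker: "bform B p x = 0" if x: "x \<in> carrier_vec N" "bform M p x = 0" for x
  proof -
    have k: "bform M (x + s \<cdot>\<^sub>v e) (x + s \<cdot>\<^sub>v e) * bform B p x = 0" for s
      using key[of "x + s \<cdot>\<^sub>v e"] x e p Be by (simp add: add_right smult_right B.add_right B.smult_right)
    have "bform M (x + 1 \<cdot>\<^sub>v e) (x + 1 \<cdot>\<^sub>v e) + bform M (x + (-1) \<cdot>\<^sub>v e) (x + (-1) \<cdot>\<^sub>v e)
        - 2 * bform M (x + 0 \<cdot>\<^sub>v e) (x + 0 \<cdot>\<^sub>v e) = 2 * bform M e e"
      using x e by (simp add: bilinear commute[of e x])
    then show ?thesis using k[of 1] k[of "-1"] k[of 0] e(3) by auto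
  qed
  \<comment> \<open>The kernel of b(p, .) lies in that of B(p, .), so the two linear forms are
    proportional; the factor is read off at \<open>z\<close>, where b(p, z) = 1.\<close>
  define k where "k = bform B p z"
  have lin: "bform B p x = k * bform M p x" if x: "x \<in> carrier_vec N" for x
    using ker[of "x + (- bform M p x) \<cdot>\<^sub>v z"] x z p
    by (simp add: bilinear B.bilinear k_def algebra_simps)
  \<comment> \<open>Inserting \<open>lin\<close> into \<open>key\<close> leaves b(p, x) as a factor
    to cancel; polarization then recovers the matrix entries.\<close>
  have quad: "bform B x x - k * bform M x x = 0" if x: "x \<in> carrier_vec N" for x
  proof (rule line_poly_mult_eq_0D[of N "bform M p" "\<lambda>x. bform B x x - k * bform M x x" z])
    show "line_poly N (\<lambda>x. bform B x x - k * bform M x x)"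
      by (intro line_poly_diff line_poly_mult line_poly_const line_poly_quadratic
        B.line_poly_quadratic)
    show "bform M p x * (bform B x x - k * bform M x x) = 0" if "x \<in> carrier_vec N" for x
      using key[OF that] lin[OF that] by (simp add: algebra_simps)
  qed (use p z x in auto)
  have pol: "bform B x x' = k * bform M x x'"
    if "x \<in> carrier_vec N" "x' \<in> carrier_vec N" for x x'
    using quad[of "x + x'"] quad[of x] quad[of x'] that
    by (simp add: bilinear B.bilinear commute[of x' x] B.commute[of x' x] algebra_simps)
  have "B = k \<cdot>\<^sub>m M"
  proof (rule eq_matI)
    fix i j assume "i < dim_row (k \<cdot>\<^sub>m M)" "j < dim_col (k \<cdot>\<^sub>m M)"
    then have "i < N" "j < N" using carrier by auto
    then show "B $$ (i, j) = (k \<cdot>\<^sub>m M) $$ (i, j)"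
      using pol[of "unit_vec N i" "unit_vec N j"] carrier
      by (simp add: unit_vec_entry B.unit_vec_entry)
  qed (use carrier B.carrier in auto)
  then show ?thesis ..
qed

end

subsection \<open>Quadrics in homogeneous coordinates\<close>

lemma lift_carrier: "lift n x \<in> carrier_vec (n + 1)"
  by (simp add: lift_def)

lemma lift_dehom:
  assumes "a \<in> carrier_vec (n + 1)" "a $ n \<noteq> 0"
  shows "lift n (dehom n a) = (1 / a $ n) \<cdot>\<^sub>v a"
  using assms by (intro eq_vecI) (auto simp: lift_def dehom_def less_Suc_eq)

lemma (in symmetric_form) bform_smult_smult:
  assumes "x \<in> carrier_vec N"
  shows "bform M (c \<cdot>\<^sub>v x) (c \<cdot>\<^sub>v x) = c\<^sup>2 * bform M x x"
  using assms by (simp add: bilinear power2_eq_square)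

lemma (in symmetric_form) congruence:
  assumes A: "A \<in> carrier_mat N N"
  shows "symmetric_form N (transpose_mat A * M * A)"
    and "\<lbrakk>x \<in> carrier_vec N; y \<in> carrier_vec N\<rbrakk>
      \<Longrightarrow> bform (transpose_mat A * M * A) x y = bform M (A *\<^sub>v x) (A *\<^sub>v y)"
proof -
  have AT: "transpose_mat A \<in> carrier_mat N N" using A by simp
  show "symmetric_form N (transpose_mat A * M * A)"
    using A AT carrier
    by unfold_locales
      (simp_all add: transpose_mult[of _ N N _ N] assoc_mult_mat[of _ N N _ N _ N] sym)
  assume xy: "x \<in> carrier_vec N" "y \<in> carrier_vec N"
  have "(transpose_mat A * M * A) *\<^sub>v y = transpose_mat A *\<^sub>v (M *\<^sub>v (A *\<^sub>v y))"
    using A AT carrier xy by (simp add: assoc_mult_mat_vec[of _ N N _ N])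
  then show "bform (transpose_mat A * M * A) x y = bform M (A *\<^sub>v x) (A *\<^sub>v y)"
    using transpose_vec_mult_scalar[OF AT, of "M *\<^sub>v (A *\<^sub>v y)" x] A carrier xy
    by (simp add: bform_def)
qed

text \<open>All conditions on \<open>v\<close> are unchanged by nonzero scaling, and the lift of
  F(X) is a multiple of A times the lift of X. The excluded hyperplanes are the one at infinity and
  the one given by the polar set.\<close>

lemma proj_invariant_quadric_iff:
  assumes A: "A \<in> carrier_mat (n + 1) (n + 1)" and M: "symmetric_form (n + 1) M"
  shows "proj_invariant n A (quadric n M) \<longleftrightarrow>
    (\<forall>v \<in> carrier_vec (n + 1). v $ n \<noteq> 0 \<longrightarrow> (A *\<^sub>v v) $ n \<noteq> 0 \<longrightarrow>
      bform M v v = 0 \<longrightarrow> bform M (A *\<^sub>v v) (A *\<^sub>v v) = 0)"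
    (is "?inv \<longleftrightarrow> ?cone")
proof -
  interpret symmetric_form "n + 1" M by (fact M)
  have quadric: "X \<in> quadric n M \<longleftrightarrow> X \<in> carrier_vec n \<and> bform M (lift n X) (lift n X) = 0" for X
    by (simp add: quadric_def bform_def)
  have image: "proj_map n A X \<in> quadric n M \<longleftrightarrow>
      bform M (A *\<^sub>v lift n X) (A *\<^sub>v lift n X) = 0"
    if "(A *\<^sub>v lift n X) $ n \<noteq> 0" for X
  proof -
    have c: "A *\<^sub>v lift n X \<in> carrier_vec (n + 1)" using A lift_carrier by simp
    have "proj_map n A X \<in> carrier_vec n" by (simp add: proj_map_def dehom_def)
    then show ?thesis
      unfolding quadric using lift_dehom[OF c that] bform_smult_smult[OF c] that
      by (simp add: proj_map_def)
  qed
  show ?thesis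
  proof
    assume inv: ?inv
    show ?cone
    proof (intro ballI impI)
      fix v assume v: "v \<in> carrier_vec (n + 1)" "v $ n \<noteq> 0" "(A *\<^sub>v v) $ n \<noteq> 0" "bform M v v = 0"
      let ?c = "1 / v $ n"
      have l: "lift n (dehom n v) = ?c \<cdot>\<^sub>v v" using lift_dehom v by blast
      have Al: "A *\<^sub>v lift n (dehom n v) = ?c \<cdot>\<^sub>v (A *\<^sub>v v)"
        unfolding l using mult_mat_vec[OF A v(1)] .
      have Av: "A *\<^sub>v v \<in> carrier_vec (n + 1)" using A v by simp
      have "dehom n v \<in> quadric n M"
        unfolding quadric using l bform_smult_smult[OF v(1)] v(4) by (simp add: dehom_def)
      moreover have nz: "(A *\<^sub>v lift n (dehom n v)) $ n \<noteq> 0"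
        unfolding Al using v(2,3) A by simp
      ultimately have "proj_map n A (dehom n v) \<in> quadric n M"
        using inv by (auto simp: proj_invariant_def polar_set_def last_proj_def)
      then show "bform M (A *\<^sub>v v) (A *\<^sub>v v) = 0"
        unfolding image[OF nz] unfolding Al bform_smult_smult[OF Av] using v(2) by simp
    qed
  next
    assume cone: ?cone
    show ?inv
      unfolding proj_invariant_def
    proof (rule image_subsetI)
      fix X assume "X \<in> quadric n M - polar_set n A"
      then have X: "bform M (lift n X) (lift n X) = 0" "(A *\<^sub>v lift n X) $ n \<noteq> 0"
        by (auto simp: quadric polar_set_def last_proj_def)
      moreover have "lift n X $ n \<noteq> 0" by (simp add: lift_def)
      ultimately show "proj_map n A X \<in> quadric n M"
        using cone lift_carrier image by blast
    qed
  qed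
qed

section \<open>From the congruence to similarity with the scaled inverse\<close>

lemma similar_inverse_of_congruence:
  fixes A M :: "real mat"
  assumes A: "A \<in> carrier_mat N N" "det A \<noteq> 0" and M: "M \<in> carrier_mat N N" "det M \<noteq> 0"
    and eq: "transpose_mat A * M * A = \<epsilon> \<cdot>\<^sub>m M"
  shows "similar_mat A (\<epsilon> \<cdot>\<^sub>m inv_mat A)"
proof -
  let ?C = "\<epsilon> \<cdot>\<^sub>m inv_mat A"
  note IA = inv_mat[OF A] and IM = inv_mat[OF M]
  have C: "?C \<in> carrier_mat N N" using IA by simp
  have TM: "transpose_mat A * M \<in> carrier_mat N N" using A M by simp
  \<comment> \<open>Multiplying the congruence by the inverse of \<open>A\<close> on the right gives
    A^T M = M (\<epsilon> A^-1).\<close>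
  have "transpose_mat A * M = transpose_mat A * M * (A * inv_mat A)"
    using right_mult_one_mat[OF TM] IA(2) by simp
  also have "\<dots> = transpose_mat A * M * A * inv_mat A"
    using assoc_mult_mat[OF TM A(1) IA(1)] by simp
  also have "\<dots> = M * ?C"
    unfolding eq mult_smult_distrib[OF M(1) IA(1)] mult_smult_assoc_mat[OF M(1) IA(1)] ..
  finally have MC: "transpose_mat A * M = M * ?C" .
  have "inv_mat M * transpose_mat A * M = inv_mat M * (transpose_mat A * M)"
    using A M IM by simp
  also have "\<dots> = inv_mat M * M * ?C"
    unfolding MC by (rule assoc_mult_mat[symmetric]) (use M IM C in auto)
  finally have "?C = inv_mat M * transpose_mat A * M" using left_mult_one_mat[OF C] IM(3) by simp
  then have "similar_mat ?C (transpose_mat A)"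
    using A M IM C by (intro similar_matI[of _ _ "inv_mat M" M N]) auto
  then show ?thesis
    using similar_transpose_real[OF A(1)] similar_mat_sym similar_mat_trans by blast
qed

theorem corollary6:
  fixes n :: nat and A M :: "real mat"
  assumes "n \<ge> 2"
    and "A \<in> carrier_mat (n + 1) (n + 1)"
    and "det A = 1 \<or> det A = -1"
    and "M \<in> carrier_mat (n + 1) (n + 1)"
    and "invertible_mat M"
    and "symmetric_matrix M"
    and "indefinite_matrix M"
  shows "(proj_invariant n A (quadric n M) \<longleftrightarrow>
            (\<exists>\<epsilon>\<in>{1, -1 :: real}. transpose_mat A * M * A = \<epsilon> \<cdot>\<^sub>m M)) \<and>
         (\<forall>\<epsilon>\<in>{1, -1 :: real}. transpose_mat A * M * A = \<epsilon> \<cdot>\<^sub>m M \<longrightarrow>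
            similar_mat A (\<epsilon> \<cdot>\<^sub>m inv_mat A))"
proof -
  let ?N = "n + 1" and ?B = "transpose_mat A * M * A"
  note A = assms(2) and M = assms(4)
  have dA: "det A \<noteq> 0" using assms(3) by auto
  obtain M' where M': "M * M' = 1\<^sub>m ?N" "M' * M = 1\<^sub>m (dim_row M')"
    using assms(5) M by (auto simp: invertible_mat_def inverts_mat_def)
  then have "M' \<in> carrier_mat ?N ?N"
    using M by (metis carrier_matD(2) carrier_matI index_mult_mat(2,3) index_one_mat(2,3))
  then have "det M * det M' = 1"
    using det_mult[OF M] M'(1) by (metis det_one)
  then have dM: "det M \<noteq> 0" by auto
  interpret nondegenerate_form ?N M
    using M dM assms(6) by unfold_locales (auto simp: symmetric_matrix_def)
  note invariant_iff = proj_invariant_quadric_iff[OF A symmetric_form_axioms]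
  have B: "symmetric_form ?N ?B" using congruence(1)[OF A] .
  have Bform: "bform ?B x x = bform M (A *\<^sub>v x) (A *\<^sub>v x)" if "x \<in> carrier_vec ?N" for x
    using congruence(2)[OF A that that] .
  have "\<exists>\<epsilon>\<in>{1, -1}. ?B = \<epsilon> \<cdot>\<^sub>m M" if inv: "proj_invariant n A (quadric n M)"
  proof -
    obtain u w where uw: "u \<in> carrier_vec ?N" "bform M u u > 0" "w \<in> carrier_vec ?N" "bform M w w < 0"
      using assms(7) M by (auto simp: indefinite_matrix_def bform_def)
    obtain p where p: "p \<in> carrier_vec ?N" "p \<noteq> 0\<^sub>v ?N" "bform M p p = 0"
      using isotropic_vec[OF uw] .
    \<comment> \<open>The two hyperplanes are given by the last unit vector (infinity) and the last
      row of \<open>A\<close> (polar set).\<close>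
    have e: "unit_vec ?N n \<bullet> x = x $ n" if "x \<in> carrier_vec ?N" for x :: "real vec"
      using that by simp
    have r: "row A n \<bullet> x = (A *\<^sub>v x) $ n" for x using A by simp
    have rc: "row A n \<in> carrier_vec ?N" using A by (intro row_carrier_vec[of _ ?N]) auto
    have rnz: "row A n \<noteq> 0\<^sub>v ?N"
    proof
      assume 0: "row A n = 0\<^sub>v ?N"
      \<comment> \<open>A preimage of the last unit vector under \<open>A\<close> has product 1 with
        the last row, so this row is nonzero.\<close>
      let ?x = "inv_mat A *\<^sub>v unit_vec ?N n"
      have "A *\<^sub>v ?x = unit_vec ?N n"
        using A inv_mat[OF A dA] by (simp flip: assoc_mult_mat_vec[of _ ?N ?N _ ?N])
      then have "row A n \<bullet> ?x = 1" using r by simp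
      then show False using 0 inv_mat(1)[OF A dA] by simp
    qed
    have "\<exists>k. ?B = k \<cdot>\<^sub>m M"
    proof (rule quadratic_form_multiple[OF B _ p _ _ rc rnz])
      show "unit_vec ?N n \<in> carrier_vec ?N" "unit_vec ?N n \<noteq> 0\<^sub>v ?N" by simp_all
      show "bform ?B x x = 0" if "x \<in> carrier_vec ?N" "bform M x x = 0"
        "unit_vec ?N n \<bullet> x \<noteq> 0" "row A n \<bullet> x \<noteq> 0" for x
        using inv that unfolding invariant_iff Bform[OF that(1)] e[OF that(1)] r by blast
    qed (use assms(1) in simp)
    then obtain k where k: "?B = k \<cdot>\<^sub>m M" ..
    \<comment> \<open>The square of det A is 1, while scaling by \<open>k\<close> multiplies the
      determinant by k^(n + 1). The sign of \<open>k\<close> is undetermined when n + 1 is even,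
      hence the passage to \<bar>k\<bar>.\<close>
    have "det ?B = det M"
      using A M assms(3) by (auto simp: det_mult[of _ ?N] det_transpose)
    then have "k ^ ?N = 1"
      using dM M by (simp add: k)
    then have "\<bar>k\<bar> ^ Suc n = 1 ^ Suc n"
      unfolding power_abs[symmetric] by simp
    then have "\<bar>k\<bar> = 1"
      by (rule power_inject_base) simp_all
    then show ?thesis using k by (auto simp: abs_if split: if_splits)
  qed
  \<comment> \<open>The converse holds for every real factor: a multiple of the form still vanishes
    on the cone.\<close>
  moreover have "proj_invariant n A (quadric n M)" if "?B = \<epsilon> \<cdot>\<^sub>m M" for \<epsilon>
    unfolding invariant_iff
  proof (intro ballI impI)
    fix v assume v: "v \<in> carrier_vec ?N" "bform M v v = 0"
    have "bform M (A *\<^sub>v v) (A *\<^sub>v v) = bform (\<epsilon> \<cdot>\<^sub>m M) v v" using Bform[OF v(1)] that by simp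
    also have "\<dots> = \<epsilon> * bform M v v"
      using smult_mat v by simp
    finally show "bform M (A *\<^sub>v v) (A *\<^sub>v v) = 0" using v by simp
  qed
  moreover have "similar_mat A (\<epsilon> \<cdot>\<^sub>m inv_mat A)" if "?B = \<epsilon> \<cdot>\<^sub>m M" for \<epsilon>
    using similar_inverse_of_congruence[OF A dA M dM that] .
  ultimately show ?thesis by blast
qed

end
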